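(* For integers $n,d\ge 0$ let $c_{n,d}$ denote the number of $d$-dimensional cubes in the configuration space $\mathcal{S}_{2,n}$ of the robotic arm of length $n$ in a tunnel of width $2$. Then, as formal power series, $$\sum_{n,d\ge 0} c_{n,d}\,x^n y^d=\frac{1+xy+x^2+x^2y+x^3+3x^3y+x^3y^2+2x^4y+2x^4y^2+x^5y^2}{1-2x+x^2-x^3-x^4-2x^4y-2x^5y-x^5y^2-x^6y^2}.$$
   Context: **Positions.** A position of the robotic arm of length $n$ in a tunnel of width $2$ is a lattice path of $n$ unit links starting at $(0,0)$, each link facing up ($u$), down ($d$) or right ($r$), staying in the strip $0\le y\le 2$ and not intersecting itself; equivalently a word in $\{u,d,r\}^n$ with no two consecutive letters $ud$ or $du$ and all heights in $[0,2]$. For $n=0$ there is exactly one (empty) position. **Moves.** (Switch corners) two consecutive links facing different directions (one vertical, one horizontal) interchange directions; (flip the end) the last link rotates by $90^\circ$ ($r\leftrightarrow u$ or $r\leftrightarrow d$). A move is legal only if its result is a position. **Configuration space.** $\mathcal{S}_{2,n}$ is the cubical complex whose vertices are the positions, whose edges are the legal moves, and whose $k$-cubes correspond to $k$-tuples of commutative moves: given $k$ moves applicable at a position $p$, acting on pairwise disjoint sets of links and such that performing any subset of them yields a position, the $2^k$ positions obtained from $p$ by performing the subsets of these moves are the vertices of a $k$-cube (a cube is determined by its set of vertices). *)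

theory Defs
  imports "HOL-Computational_Algebra.Formal_Power_Series"
begin

datatype link = Up | Down | Right

fun vertical :: "link \<Rightarrow> bool" where
  "vertical Up = True"
| "vertical Down = True"
| "vertical Right = False"

fun endpoint :: "int \<times> int \<Rightarrow> link \<Rightarrow> int \<times> int" where
  "endpoint (x, y) Up = (x, y + 1)"
| "endpoint (x, y) Down = (x, y - 1)"
| "endpoint (x, y) Right = (x + 1, y)"

text \<open>The lattice points visited, in order, by the arm with base point \<open>P\<close>.\<close>
fun joints :: "int \<times> int \<Rightarrow> link list \<Rightarrow> (int \<times> int) list" where
  "joints P [] = [P]"
| "joints P (l # w) = P # joints (endpoint P l) w"

text \<open>A path of unit lattice links does not intersect itself iff it visits no lattice point twice.\<close>
definition position :: "nat \<Rightarrow> link list \<Rightarrow> bool" where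
  "position n w \<longleftrightarrow>
     length w = n \<and>
     distinct (joints (0, 0) w) \<and>
     (\<forall>(x, y) \<in> set (joints (0, 0) w). 0 \<le> y \<and> y \<le> 2)"

definition reverses :: "link \<Rightarrow> link \<Rightarrow> bool" where
  "reverses l l' \<longleftrightarrow> (l = Up \<and> l' = Down) \<or> (l = Down \<and> l' = Up)"

lemma fst_joints: "Q \<in> set (joints P w) \<Longrightarrow> fst P \<le> fst Q"
proof (induction w arbitrary: P)
  case (Cons l w)
  have "fst P \<le> fst (endpoint P l)" by (cases P; cases l) auto
  with Cons show ?case by fastforce
qed auto

lemma joints_Up:
  "\<lbrakk>successively (\<lambda>l l'. \<not> reverses l l') (Up # w); Q \<in> set (joints (endpoint P Up) w)\<rbrakk>
    \<Longrightarrow> fst P < fst Q \<or> snd P < snd Q"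
proof (induction w arbitrary: P)
  case Nil then show ?case by (cases P) auto
next
  case (Cons l w)
  obtain x y where P: "P = (x, y)" by (cases P)
  show ?case
  proof (cases l)
    case Up
    with Cons.prems Cons.IH[of "endpoint P Up"] P show ?thesis by auto
  next
    case Down
    with Cons.prems show ?thesis by (simp add: reverses_def)
  next
    case Right
    with Cons.prems fst_joints[of Q "(x + 1, y + 1)" w] P show ?thesis by auto
  qed
qed

lemma joints_Down:
  "\<lbrakk>successively (\<lambda>l l'. \<not> reverses l l') (Down # w); Q \<in> set (joints (endpoint P Down) w)\<rbrakk>
    \<Longrightarrow> fst P < fst Q \<or> snd Q < snd P"
proof (induction w arbitrary: P)
  case Nil then show ?case by (cases P) auto
next
  case (Cons l w)
  obtain x y where P: "P = (x, y)" by (cases P)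
  show ?case
  proof (cases l)
    case Down
    with Cons.prems Cons.IH[of "endpoint P Down"] P show ?thesis by auto
  next
    case Up
    with Cons.prems show ?thesis by (simp add: reverses_def)
  next
    case Right
    with Cons.prems fst_joints[of Q "(x + 1, y - 1)" w] P show ?thesis by auto
  qed
qed

lemma joints_not_hd:
  assumes "successively (\<lambda>l l'. \<not> reverses l l') (l # w)"
  shows "P \<notin> set (joints (endpoint P l) w)"
proof (cases l)
  case Up then show ?thesis using joints_Up[of w P P] assms by auto
next
  case Down then show ?thesis using joints_Down[of w P P] assms by auto
next
  case Right
  then show ?thesis using fst_joints[of P "endpoint P l" w] by (cases P) auto
qed

lemma distinct_joints_iff:
  "distinct (joints P w) \<longleftrightarrow> successively (\<lambda>l l'. \<not> reverses l l') w"
proof (induction w arbitrary: P)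
  case (Cons l w)
  have "P \<in> set (joints (endpoint P l) w)" if ne: "w \<noteq> []" and rev: "reverses l (hd w)"
  proof -
    obtain l' v where w: "w = l' # v" using ne by (cases w) auto
    have "P \<in> set (joints P v)" by (cases v) auto
    moreover have "endpoint (endpoint P l) l' = P"
      using rev w by (cases P) (auto simp: reverses_def)
    ultimately show ?thesis using w by simp
  qed
  with Cons joints_not_hd[of l w P] show ?case by (auto simp: successively_Cons)
qed simp

text \<open>Positions as words: no two consecutive letters are opposite, and all heights lie in the strip.\<close>
lemma position_iff:
  "position n w \<longleftrightarrow>
     length w = n \<and>
     successively (\<lambda>l l'. \<not> reverses l l') w \<and>
     (\<forall>(x, y) \<in> set (joints (0, 0) w). 0 \<le> y \<and> y \<le> 2)"
  by (simp add: position_def distinct_joints_iff)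

text \<open>
  Links are numbered from \<open>0\<close>. \<open>Switch i\<close> acts on the links \<open>i\<close> and \<open>i + 1\<close>; \<open>Flip l\<close> makes the
  last link face in direction \<open>l\<close>, so a horizontal last link admits two different flips.
\<close>
datatype move = Switch nat | Flip link

fun perform :: "move \<Rightarrow> link list \<Rightarrow> link list" where
  "perform (Switch i) w = w[i := w ! Suc i, Suc i := w ! i]"
| "perform (Flip l) w = w[length w - 1 := l]"

fun affected_links :: "nat \<Rightarrow> move \<Rightarrow> nat set" where
  "affected_links n (Switch i) = {i, Suc i}"
| "affected_links n (Flip l) = {n - 1}"

fun applicable :: "move \<Rightarrow> link list \<Rightarrow> bool" where
  "applicable (Switch i) w \<longleftrightarrow> Suc i < length w \<and> vertical (w ! i) \<noteq> vertical (w ! Suc i)"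
| "applicable (Flip l) w \<longleftrightarrow> w \<noteq> [] \<and> vertical (last w) \<noteq> vertical l"

definition legal :: "nat \<Rightarrow> link list \<Rightarrow> move \<Rightarrow> bool" where
  "legal n p m \<longleftrightarrow> applicable m p \<and> position n (perform m p)"

text \<open>
  A tuple of moves is a list, and its subsets are its \<open>subseqs\<close>. As the moves act on disjoint sets
  of links, performing a subset one move after the other does not depend on the order.
\<close>
definition commutative_moves :: "nat \<Rightarrow> link list \<Rightarrow> move list \<Rightarrow> bool" where
  "commutative_moves n p ms \<longleftrightarrow>
     (\<forall>m \<in> set ms. legal n p m) \<and>
     sorted_wrt (\<lambda>m m'. affected_links n m \<inter> affected_links n m' = {}) ms \<and>
     (\<forall>s \<in> set (subseqs ms). position n (fold perform s p))"

definition cube_vertices :: "link list \<Rightarrow> move list \<Rightarrow> link list set" where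
  "cube_vertices p ms = (\<lambda>s. fold perform s p) ` set (subseqs ms)"

text \<open>The \<open>d\<close>-dimensional cubes of the configuration space, each given by its set of vertices.\<close>
definition cubes :: "nat \<Rightarrow> nat \<Rightarrow> link list set set" where
  "cubes n d =
     {cube_vertices p ms | p ms. position n p \<and> length ms = d \<and> commutative_moves n p ms}"

definition num_cubes :: "nat \<Rightarrow> nat \<Rightarrow> nat" where
  "num_cubes n d = card (cubes n d)"

text \<open>
  Power series in \<open>x\<close> and \<open>y\<close> are power series in \<open>x\<close> whose coefficients are power series in \<open>y\<close>.
\<close>
definition bivariate_fps :: "(nat \<Rightarrow> nat \<Rightarrow> rat) \<Rightarrow> rat fps fps" where
  "bivariate_fps a = Abs_fps (\<lambda>n. Abs_fps (\<lambda>d. a n d))"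

definition var_x :: "rat fps fps" where "var_x = fps_X"

definition var_y :: "rat fps fps" where "var_y = fps_const fps_X"

text \<open>
  \<open>rat fps\<close> is not a field, so the library's division on \<open>rat fps fps\<close> is the genuine quotient
  only when the constant term of the denominator is invertible.
\<close>
lemma bivariate_fps_quotient_iff:
  fixes f g h :: "rat fps fps"
  assumes "fps_nth g 0 = 1"
  shows "f = h / g \<longleftrightarrow> f * g = h"
proof -
  have inv1: "inverse (1 :: rat fps) = 1"
    by (rule fps_inverse_one)
  have inv: "g * inverse g = 1"
    unfolding fps_inverse_def[of g] assms inv1 by (rule fps_right_inverse) (simp add: assms)
  have "h / g = h * inverse g"
    using assms by (simp add: fps_divide_unit)
  moreover have "h * inverse g * g = h" "f * g * inverse g = f"
    using inv by (simp_all only: mult.assoc mult.commute[of "inverse g" g] mult_1_right)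
  ultimately show ?thesis by auto
qed

end

theory Submission
  imports Defs
begin

text \<open>
  A cube is a word with gaps: links that no move touches, corners (a vertical link and a horizontal
  one, in either order) and possibly a last link that may be flipped. All its vertices are positions
  iff the word obeys the same height and non-reversal constraints as a position, where a corner
  counts like its vertical link: it changes the height in the same way, and it forbids the same
  neighbours since its vertical link may come first or second. So the cubes are accepted by an
  automaton whose state is the height together with the direction of the last letter, in which a
  vertical step has weight \<open>a = x + x\<^sup>2y\<close> and a final flip has weight \<open>xy\<close>. Eliminating
  the other states, the generating function \<open>F\<close> of the initial state satisfies
  \<open>F ((1 - x)\<^sup>2 - a\<^sup>2x(1 + x)) = (1 + xy)(1 - x) + a (1 + (1 + x)(a + xy))\<close>.
\<close>

section \<open>Cubes as words with gaps\<close>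

text \<open>\<open>Corner\<close> and \<open>Tip\<close> store only their vertical direction; the
  other direction is always \<open>Right\<close>. A \<open>Tip\<close> has no continuation because a
  flip acts on the last link. With this encoding a cube has exactly one well-formed cell.\<close>

datatype cell = Done | Tip link | Fixed link cell | Corner link cell

fun language :: "cell \<Rightarrow> link list set" where
  "language Done = {[]}"
| "language (Tip l) = {[l], [Right]}"
| "language (Fixed l c) = (#) l ` language c"
| "language (Corner l c) =
     (\<lambda>w. l # Right # w) ` language c \<union> (\<lambda>w. Right # l # w) ` language c"

fun cell_length :: "cell \<Rightarrow> nat" where
  "cell_length Done = 0"
| "cell_length (Tip l) = 1"
| "cell_length (Fixed l c) = Suc (cell_length c)"
| "cell_length (Corner l c) = Suc (Suc (cell_length c))"

fun cell_dim :: "cell \<Rightarrow> nat" where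
  "cell_dim Done = 0"
| "cell_dim (Tip l) = 1"
| "cell_dim (Fixed l c) = cell_dim c"
| "cell_dim (Corner l c) = Suc (cell_dim c)"

fun well_formed :: "cell \<Rightarrow> bool" where
  "well_formed Done = True"
| "well_formed (Tip l) = vertical l"
| "well_formed (Fixed l c) = well_formed c"
| "well_formed (Corner l c) = (vertical l \<and> well_formed c)"

lemma language_nonempty: "language c \<noteq> {}"
  by (induction c) auto

lemma length_language: "w \<in> language c \<Longrightarrow> length w = cell_length c"
  by (induction c arbitrary: w) auto

lemma vertical_neq_Right: "vertical l \<longleftrightarrow> l \<noteq> Right"
  by (cases l) auto

section \<open>Left quotients by a letter, and uniqueness of the cell of a cube\<close>

definition tails :: "link \<Rightarrow> link list set \<Rightarrow> link list set" where
  "tails l L = {w. l # w \<in> L}"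

lemma tails_language:
  "tails l (language (Fixed l' c)) = (if l = l' then language c else {})"
  "vertical l' \<Longrightarrow> tails l (language (Corner l' c)) =
    (if l = l' then (#) Right ` language c else if l = Right then (#) l' ` language c else {})"
  "vertical l' \<Longrightarrow> tails l (language (Tip l')) = (if l = l' \<or> l = Right then {[]} else {})"
  by (auto simp: tails_def vertical_neq_Right)

lemma Cons_image_eq_iff: "(#) a ` A = (#) a ` B \<longleftrightarrow> A = B"
  by (rule inj_image_eq_iff) simp

text \<open>Left quotients reveal the outermost constructor: \<open>Fixed\<close> has one nonempty
  quotient, while \<open>Tip\<close> and \<open>Corner\<close> have two, by their vertical letter
  and by \<open>Right\<close>. \<open>Tip\<close> and \<open>Corner\<close> differ in word length.
  The quotients then give the language of the remaining cell. Hence counting vertex sets is counting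
  cells.\<close>

lemma language_inject:
  "\<lbrakk>well_formed c; well_formed c'; language c = language c'\<rbrakk> \<Longrightarrow> c = c'"
proof (induction c arbitrary: c')
  case Done
  then show ?case by (cases c') (auto simp: language_nonempty)
next
  case (Tip l)
  from Tip.prems have t: "tails a (language (Tip l)) = tails a (language c')" for a by simp
  from Tip.prems language_nonempty[of "Tip l"]
  have len: "cell_length c' = 1" by (metis cell_length.simps(2) ex_in_conv length_language)
  show ?case
  proof (cases c')
    case (Fixed l' b)
    then show ?thesis using Tip.prems(1,2) t[of l] t[of Right]
      by (auto simp del: language.simps simp: tails_language vertical_neq_Right split: if_splits)
  qed (use Tip.prems len in \<open>auto simp: vertical_neq_Right\<close>)
next
  case (Fixed l b)
  from Fixed.prems have t: "tails a (language (Fixed l b)) = tails a (language c')" for a by simp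
  show ?case
  proof (cases c')
    case (Tip l')
    then show ?thesis using Fixed.prems(1,2) t[of l'] t[of Right]
      by (auto simp del: language.simps simp: tails_language vertical_neq_Right split: if_splits)
  next
    case (Fixed l' b')
    then show ?thesis using Fixed.prems(1,2) Fixed.IH[of b'] t[of l]
      by (auto simp del: language.simps simp: tails_language language_nonempty split: if_splits)
  next
    case (Corner l' b')
    then show ?thesis using Fixed.prems(1,2) t[of l'] t[of Right]
      by (auto simp del: language.simps simp: tails_language vertical_neq_Right language_nonempty split: if_splits)
  qed (use Fixed.prems in \<open>auto simp: language_nonempty\<close>)
next
  case (Corner l b)
  from Corner.prems have t: "tails a (language (Corner l b)) = tails a (language c')" for a by simp
  show ?case
  proof (cases c')
    case (Tip l')
    with Corner.prems language_nonempty[of "Corner l b"]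
    have "cell_length (Corner l b) = 1" by (metis cell_length.simps(2) ex_in_conv length_language)
    then show ?thesis by simp
  next
    case (Fixed l' b')
    then show ?thesis using Corner.prems(1,2) t[of l] t[of Right]
      by (auto simp del: language.simps simp: tails_language vertical_neq_Right language_nonempty split: if_splits)
  next
    case c': (Corner l' b')
    \<comment> \<open>The quotient by \<open>l\<close> is nonempty, and \<open>l\<close> is not
      \<open>Right\<close>, so \<open>l\<close> must be the vertical letter of the other
      corner.\<close>
    have "l = l'" using t[of l] c' Corner.prems(1,2)
      by (auto simp del: language.simps simp: tails_language vertical_neq_Right language_nonempty split: if_splits)
    moreover have "language b = language b'" using t[of l] c' Corner.prems(1,2) \<open>l = l'\<close>
      by (simp del: language.simps add: tails_language Cons_image_eq_iff)
    ultimately show ?thesis using Corner.IH[of b'] Corner.prems c' by simp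
  qed (use Corner.prems in \<open>auto simp: language_nonempty\<close>)
qed

section \<open>Vertex sets of tuples of moves\<close>

definition disjoint_moves :: "nat \<Rightarrow> move list \<Rightarrow> bool" where
  "disjoint_moves n = sorted_wrt (\<lambda>m m'. affected_links n m \<inter> affected_links n m' = {})"

lemma disjoint_moves_Nil [simp]: "disjoint_moves n []"
  by (simp add: disjoint_moves_def)

lemma disjoint_moves_Cons [simp]:
  "disjoint_moves n (m # ms) \<longleftrightarrow>
     (\<forall>m' \<in> set ms. affected_links n m \<inter> affected_links n m' = {}) \<and> disjoint_moves n ms"
  by (simp add: disjoint_moves_def)

lemma disjoint_moves_middle:
  "disjoint_moves n (xs @ m # ys) \<longleftrightarrow> disjoint_moves n (m # xs @ ys)"
  by (simp add: disjoint_moves_def sorted_wrt_append ball_Un Int_commute) blast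

text \<open>The part of \<open>commutative_moves\<close> that does not mention heights. It passes to
  suffixes of the word, whereas a suffix of a position may leave the strip when it is started at the
  origin.\<close>

definition independent :: "link list \<Rightarrow> move list \<Rightarrow> bool" where
  "independent p ms \<longleftrightarrow> (\<forall>m \<in> set ms. applicable m p) \<and> disjoint_moves (length p) ms"

lemma length_perform [simp]: "length (perform m w) = length w"
  by (cases m) auto

lemma applicable_affected: "applicable m w \<Longrightarrow> affected_links (length w) m \<subseteq> {..<length w}"
  by (cases m) auto

lemma perform_commute:
  assumes "affected_links (length w) m \<inter> affected_links (length w) m' = {}"
    and "affected_links (length w) m \<subseteq> {..<length w}"
    and "affected_links (length w) m' \<subseteq> {..<length w}"
  shows "perform m (perform m' w) = perform m' (perform m w)"
  using assms
  by (cases m; cases m') (auto intro!: nth_equalityI simp: nth_list_update)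

lemma cube_vertices_Nil [simp]: "cube_vertices p [] = {p}"
  by (simp add: cube_vertices_def)

text \<open>Performing \<open>m\<close> or not splits the cube into two opposite facets.\<close>

lemma cube_vertices_Cons:
  "cube_vertices p (m # ms) = cube_vertices p ms \<union> cube_vertices (perform m p) ms"
  by (auto simp: cube_vertices_def Let_def image_Un image_image)

lemma self_in_cube_vertices: "p \<in> cube_vertices p ms"
  by (induction ms) (auto simp: cube_vertices_Cons)

text \<open>Disjoint moves commute, so the move acting on the first link can be brought to the front
  of the list.\<close>

lemma cube_vertices_middle:
  assumes "disjoint_moves (length p) (xs @ m # ys)"
    and "\<forall>m' \<in> set (xs @ m # ys). affected_links (length p) m' \<subseteq> {..<length p}"
  shows "cube_vertices p (xs @ m # ys) = cube_vertices p (m # xs @ ys)"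
  using assms
proof (induction xs arbitrary: p)
  case (Cons x xs)
  have "perform x (perform m p) = perform m (perform x p)"
    using Cons.prems by (intro perform_commute) auto
  then show ?case
    using Cons.IH[of p] Cons.IH[of "perform x p"] Cons.prems
    by (auto simp: cube_vertices_Cons)
qed simp

section \<open>Adding and removing a first link\<close>

fun shift :: "move \<Rightarrow> move" where
  "shift (Switch i) = Switch (Suc i)"
| "shift (Flip l) = Flip l"

text \<open>A flip acts at the end of the word, so only switches are renumbered. For
  \<open>w = []\<close> the hypothesis excludes \<open>Flip\<close>, since \<open>0 - 1 = 0\<close>
  is not a valid index; otherwise the flip would hit the new link.\<close>

lemma perform_shift:
  "affected_links (length w) m \<subseteq> {..<length w} \<Longrightarrow> perform (shift m) (l # w) = l # perform m w"
  by (cases m) (auto simp: Suc_diff_Suc split: nat.splits list.splits)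

lemma cube_vertices_shift:
  assumes "\<forall>m \<in> set ms. affected_links (length w) m \<subseteq> {..<length w}"
  shows "cube_vertices (l # w) (map shift ms) = (#) l ` cube_vertices w ms"
  using assms
proof (induction ms arbitrary: w)
  case (Cons m ms)
  then show ?case by (simp add: cube_vertices_Cons perform_shift image_Un)
qed simp

lemma independent_affected:
  "\<lbrakk>independent w ms; m \<in> set ms\<rbrakk> \<Longrightarrow> affected_links (length w) m \<subseteq> {..<length w}"
  using applicable_affected by (auto simp: independent_def)

lemma affected_links_shift:
  "affected_links n m \<subseteq> {..<n} \<Longrightarrow> affected_links (Suc n) (shift m) = Suc ` affected_links n m"
  by (cases m) auto

lemma disjoint_moves_shift:
  "\<forall>m \<in> set ms. affected_links n m \<subseteq> {..<n} \<Longrightarrow>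
    disjoint_moves (Suc n) (map shift ms) \<longleftrightarrow> disjoint_moves n ms"
  by (induction ms) (auto simp: affected_links_shift image_Int[symmetric])

lemma applicable_shift: "applicable m w \<Longrightarrow> applicable (shift m) (l # w)"
  by (cases m) auto

lemma independent_shift:
  assumes "independent w ms"
  shows "independent (l # w) (map shift ms)"
  using assms independent_affected[OF assms]
  by (auto simp: independent_def applicable_shift disjoint_moves_shift)

lemma unshift_move:
  assumes "applicable m (l # w)" "0 \<notin> affected_links (length (l # w)) m"
  shows "\<exists>m'. m = shift m' \<and> applicable m' w"
proof (cases m)
  case (Switch i)
  with assms show ?thesis by (intro exI[of _ "Switch (i - 1)"]) (cases i; auto)
next
  case (Flip l')
  with assms show ?thesis by (intro exI[of _ "Flip l'"]) auto
qed

lemma unshift: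
  assumes "independent (l # w) ms" "\<forall>m \<in> set ms. 0 \<notin> affected_links (length (l # w)) m"
  obtains ms' where "ms = map shift ms'" "independent w ms'"
proof -
  have "\<exists>ms'. ms = map shift ms' \<and> (\<forall>m' \<in> set ms'. applicable m' w)"
    using assms(1)[unfolded independent_def, THEN conjunct1] assms(2)
  proof (induction ms)
    case (Cons m ms)
    obtain ms' where "ms = map shift ms'" "\<forall>m' \<in> set ms'. applicable m' w"
      using Cons by auto
    moreover obtain m' where "m = shift m'" "applicable m' w"
      using unshift_move[of m l w] Cons.prems by auto
    ultimately show ?case by (intro exI[of _ "m' # ms'"]) auto
  qed simp
  then obtain ms' where ms': "ms = map shift ms'" "\<forall>m' \<in> set ms'. applicable m' w" by blast
  moreover have "disjoint_moves (length w) ms'"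
    using assms(1) ms' disjoint_moves_shift[of ms' "length w"] applicable_affected
    by (auto simp: independent_def)
  ultimately show thesis using that by (auto simp: independent_def)
qed

text \<open>The base vertex puts the vertical link first in every corner and takes the vertical
  direction at the tip. The moves are a switch for each corner and \<open>Flip Right\<close> for the
  tip.\<close>

lemma language_exists_moves:
  "well_formed c \<Longrightarrow> \<exists>p ms. independent p ms \<and> length p = cell_length c \<and>
     length ms = cell_dim c \<and> cube_vertices p ms = language c"
proof (induction c)
  case Done
  show ?case by (intro exI[of _ "[]"]) (simp add: independent_def)
next
  case (Tip l)
  then show ?case
    by (intro exI[of _ "[l]"] exI[of _ "[Flip Right]"])
      (auto simp: independent_def cube_vertices_Cons)
next
  case (Fixed l c)
  then obtain p ms where *: "independent p ms" "length p = cell_length c"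
    "length ms = cell_dim c" "cube_vertices p ms = language c" by auto
  then show ?case
    using independent_shift[OF *(1)] cube_vertices_shift[of ms p l] independent_affected[OF *(1)]
    by (intro exI[of _ "l # p"] exI[of _ "map shift ms"]) auto
next
  case (Corner l c)
  then obtain p ms where *: "independent p ms" "length p = cell_length c"
    "length ms = cell_dim c" "cube_vertices p ms = language c" by auto
  let ?ms = "map shift (map shift ms)"
  have sh: "independent (a # p) (map shift ms)" "independent (b # a # p) ?ms" for a b
    using independent_shift[OF independent_shift[OF *(1)]] independent_shift[OF *(1)] by auto
  have V: "cube_vertices (b # a # p) ?ms = (\<lambda>w. b # a # w) ` language c" for a b
    using cube_vertices_shift[of "map shift ms" "a # p" b] independent_affected[OF sh(1)]
      cube_vertices_shift[of ms p a] independent_affected[OF *(1)] *(4)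
    by (simp add: image_image)
  \<comment> \<open>Two shifts move every affected index past 1, out of reach of
    \<open>Switch 0\<close>.\<close>
  have "affected_links (length (l # Right # p)) m \<inter> {0, 1} = {}" if "m \<in> set ?ms" for m
  proof -
    from that obtain m' where m': "m' \<in> set ms" "m = shift (shift m')" by auto
    have a: "affected_links (length p) m' \<subseteq> {..<length p}"
      using independent_affected[OF *(1) m'(1)] .
    have "affected_links (Suc (length p)) (shift m') \<subseteq> {..<Suc (length p)}"
      using a affected_links_shift[OF a] by auto
    from affected_links_shift[OF this] affected_links_shift[OF a] m'(2) show ?thesis by auto
  qed
  then have "independent (l # Right # p) (Switch 0 # ?ms)"
    using sh(2)[of l Right] Corner.prems by (auto simp: independent_def)
  moreover have "cube_vertices (l # Right # p) (Switch 0 # ?ms) = language (Corner l c)"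
    using V[of l Right] V[of Right l] by (simp add: cube_vertices_Cons)
  ultimately show ?case using *(2,3)
    by (intro exI[of _ "l # Right # p"] exI[of _ "Switch 0 # ?ms"]) auto
qed

text \<open>The cell is read off from the left. If no move touches link 0, it is
  \<open>Fixed\<close>; a flip of link 0 gives \<open>Tip\<close>, and \<open>Switch 0\<close> gives
  \<open>Corner\<close>. The last case removes two links, hence the induction on length.\<close>

lemma moves_exists_language:
  "independent p ms \<Longrightarrow> \<exists>c. well_formed c \<and> length p = cell_length c \<and>
     length ms = cell_dim c \<and> cube_vertices p ms = language c"
proof (induction p arbitrary: ms rule: length_induct)
  case (1 p)
  show ?case
  proof (cases p)
    case Nil
    have "\<not> applicable m []" for m by (cases m) auto
    then have "ms = []" using 1(2) Nil by (cases ms) (auto simp: independent_def)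
    then show ?thesis using Nil by (intro exI[of _ Done]) simp
  next
    case p: (Cons l w)
    show ?thesis
    proof (cases "\<exists>m \<in> set ms. 0 \<in> affected_links (length p) m")
      case False
      then have "\<forall>m \<in> set ms. 0 \<notin> affected_links (length (l # w)) m" using p by blast
      from unshift[OF 1(2)[unfolded p] this]
      obtain ms' where ms': "ms = map shift ms'" "independent w ms'" .
      then obtain c where "well_formed c" "length w = cell_length c"
        "length ms' = cell_dim c" "cube_vertices w ms' = language c"
        using 1(1) p by (metis impossible_Cons not_le)
      then show ?thesis
        using ms' p cube_vertices_shift[of ms' w l] independent_affected[OF ms'(2)]
        by (intro exI[of _ "Fixed l c"]) auto
    next
      case True
      then obtain m where m: "m \<in> set ms" "0 \<in> affected_links (length p) m" by auto
      then obtain xs ys where ms: "ms = xs @ m # ys" by (auto simp: in_set_conv_decomp)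
      have ind: "independent p (m # xs @ ys)"
        using 1(2) ms disjoint_moves_middle[of "length p" xs m ys] by (auto simp: independent_def)
      have V: "cube_vertices p ms = cube_vertices p (m # xs @ ys)"
        using 1(2) ms cube_vertices_middle[of p xs m ys] independent_affected[OF 1(2)]
        by (simp add: independent_def)
      show ?thesis
      proof (cases m)
        case (Flip l')
        then have w: "w = []" using m(2) p by auto
        \<comment> \<open>The arm has a single link, already taken by the flip; a switch would
          require a second link.\<close>
        have "xs @ ys = []"
        proof (rule ccontr)
          assume "xs @ ys \<noteq> []"
          then obtain m' where m': "m' \<in> set (xs @ ys)" by (meson last_in_set)
          then have "applicable m' p" "0 \<notin> affected_links (length p) m'"
            using ind m(2) by (auto simp: independent_def)
          then show False using p w by (cases m') auto
        qed
        then have [simp]: "xs = []" "ys = []" by auto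
        have ll: "vertical l \<noteq> vertical l'" using ind Flip p w by (auto simp: independent_def)
        have V': "cube_vertices p ms = {[l], [l']}"
          using V Flip p w by (simp add: cube_vertices_Cons insert_commute)
        show ?thesis
          using ll V' p w ms
          \<comment> \<open>Exactly one of \<open>l\<close> and \<open>l'\<close> is vertical, and
            it is the one that the cell records.\<close>
          by (intro exI[of _ "Tip (if vertical l then l else l')"]) (auto simp: vertical_neq_Right)
      next
        case (Switch i)
        then have [simp]: "i = 0" using m(2) by auto
        obtain l' w' where w: "w = l' # w'" and ll: "vertical l \<noteq> vertical l'"
          using ind p Switch by (cases w) (auto simp: independent_def)
        have ind': "independent (l # w) (xs @ ys)" and dis:
          "\<And>m'. m' \<in> set (xs @ ys) \<Longrightarrow> affected_links (length p) m' \<inter> {0, 1} = {}"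
          using ind Switch p by (auto simp: independent_def)
        then have "\<forall>m' \<in> set (xs @ ys). 0 \<notin> affected_links (length (l # w)) m'"
          using p by blast
        from unshift[OF ind' this]
        obtain ms1 where ms1: "xs @ ys = map shift ms1" "independent w ms1" .
        \<comment> \<open>Link 0 of \<open>w\<close> is link 1 of \<open>p\<close>, which
          \<open>Switch 0\<close> occupies, so a second link can be removed.\<close>
        have "\<forall>m' \<in> set ms1. 0 \<notin> affected_links (length (l' # w')) m'"
        proof (intro ballI notI, fold w)
          fix m' assume m': "m' \<in> set ms1"
          assume "0 \<in> affected_links (length w) m'"
          then have "1 \<in> affected_links (length p) (shift m')"
            using affected_links_shift[OF independent_affected[OF ms1(2) m']] p by auto
          moreover have "shift m' \<in> set (xs @ ys)" using ms1(1) m' by auto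
          ultimately show False using dis by blast
        qed
        from unshift[OF ms1(2)[unfolded w] this]
        obtain ms2 where ms2: "ms1 = map shift ms2" "independent w' ms2" .
        then obtain c where c: "well_formed c" "length w' = cell_length c"
          "length ms2 = cell_dim c" "cube_vertices w' ms2 = language c"
          using 1(1) p w by (metis Suc_lessD length_Cons lessI)
        have V2: "cube_vertices (b # a # w') (xs @ ys) = (\<lambda>w. b # a # w) ` language c" for a b
          using cube_vertices_shift[of ms1 "a # w'" b] independent_affected[OF ms1(2)] w
            cube_vertices_shift[of ms2 w' a] independent_affected[OF ms2(2)] c(4) ms1(1) ms2(1)
          by (simp add: image_image)
        have "cube_vertices p ms =
            (\<lambda>w. l # l' # w) ` language c \<union> (\<lambda>w. l' # l # w) ` language c"
          using V Switch V2 p w by (simp add: cube_vertices_Cons)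
        moreover have "length ms = Suc (length ms2)"
          using ms ms1(1) ms2(1) by (metis add_Suc_right length_Cons length_append length_map)
        ultimately show ?thesis
          using c p w ll
          by (intro exI[of _ "Corner (if vertical l then l else l') c"])
            (auto simp: vertical_neq_Right)
      qed
    qed
  qed
qed

text \<open>Performing a single move is one of the subsets, so legality of each move reduces to its
  applicability once all vertices are positions.\<close>

lemma commutative_moves_iff:
  assumes "length p = n"
  shows "commutative_moves n p ms \<longleftrightarrow>
    independent p ms \<and> (\<forall>w \<in> cube_vertices p ms. position n w)"
proof -
  have "perform m p \<in> cube_vertices p ms" if "m \<in> set ms" for m
    using that
  proof (induction ms)
    case (Cons m' ms)
    then show ?case by (auto simp: cube_vertices_Cons self_in_cube_vertices)
  qed simp
  moreover have "commutative_moves n p ms \<longleftrightarrow> (\<forall>m \<in> set ms. legal n p m) \<and>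
      disjoint_moves n ms \<and> (\<forall>w \<in> cube_vertices p ms. position n w)"
    by (auto simp: commutative_moves_def disjoint_moves_def cube_vertices_def)
  ultimately show ?thesis
    using assms by (auto simp: independent_def legal_def)
qed

lemma cubes_eq_language:
  "cubes n d = language ` {c. well_formed c \<and> (\<forall>w \<in> language c. position n w) \<and>
     cell_length c = n \<and> cell_dim c = d}"
proof (intro equalityI subsetI)
  fix X assume "X \<in> cubes n d"
  then obtain p ms where p: "X = cube_vertices p ms" "position n p" "length ms = d"
    "commutative_moves n p ms" by (auto simp: cubes_def)
  then have "length p = n" by (simp add: position_def)
  then show "X \<in> language ` {c. well_formed c \<and> (\<forall>w \<in> language c. position n w) \<and>
     cell_length c = n \<and> cell_dim c = d}"
    using p moves_exists_language[of p ms] by (auto simp: commutative_moves_iff)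
next
  fix X assume "X \<in> language ` {c. well_formed c \<and> (\<forall>w \<in> language c. position n w) \<and>
     cell_length c = n \<and> cell_dim c = d}"
  then obtain c where c: "X = language c" "well_formed c" "\<forall>w \<in> language c. position n w"
     "cell_length c = n" "cell_dim c = d" by auto
  then obtain p ms where p: "independent p ms" "length p = n" "length ms = d"
     "cube_vertices p ms = language c" using language_exists_moves[of c] by auto
  with c(1,3) self_in_cube_vertices[of p ms] show "X \<in> cubes n d"
    unfolding cubes_def by (intro CollectI exI[of _ p] exI[of _ ms]) (simp add: commutative_moves_iff)
qed

section \<open>The automaton\<close>

fun rise :: "link \<Rightarrow> int" where
  "rise Up = 1"
| "rise Down = -1"
| "rise Right = 0"

definition admits :: "int \<Rightarrow> link \<Rightarrow> link \<Rightarrow> bool" where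
  "admits h v l \<longleftrightarrow> \<not> reverses v l \<and> h + rise l \<in> {0..2}"

fun path :: "int \<Rightarrow> link \<Rightarrow> link list \<Rightarrow> bool" where
  "path h v [] = True"
| "path h v (l # w) = (admits h v l \<and> path (h + rise l) l w)"

fun admissible :: "int \<Rightarrow> link \<Rightarrow> cell \<Rightarrow> bool" where
  "admissible h v Done = True"
| "admissible h v (Tip l) = (vertical l \<and> admits h v l)"
| "admissible h v (Fixed l c) = (admits h v l \<and> admissible (h + rise l) l c)"
| "admissible h v (Corner l c) = (vertical l \<and> admits h v l \<and> admissible (h + rise l) l c)"

text \<open>Here \<open>v\<close> stands for the link before \<open>w\<close>. The abscissa
  \<open>x0\<close> is arbitrary because it changes along the induction.\<close>

lemma path_iff:
  "h \<in> {0..2} \<Longrightarrow> path h v w \<longleftrightarrow>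
     successively (\<lambda>l l'. \<not> reverses l l') (v # w) \<and>
     (\<forall>(x, y) \<in> set (joints (x0, h) w). 0 \<le> y \<and> y \<le> 2)"
proof (induction w arbitrary: h v x0)
  case (Cons l w)
  show ?case
  proof (cases "admits h v l")
    case True
    obtain x1 where "endpoint (x0, h) l = (x1, h + rise l)" by (cases l) auto
    with True Cons.IH[of "h + rise l" l x1] Cons.prems show ?thesis by (auto simp: admits_def)
  next
    case False
    \<comment> \<open>The end of the first link is itself a visited point, so leaving the strip
      there violates the right-hand side.\<close>
    have "endpoint (x0, h) l \<in> set (joints (endpoint (x0, h) l) w)" by (cases w) auto
    moreover have "snd (endpoint (x0, h) l) = h + rise l" by (cases l) auto
    ultimately show ?thesis using False by (fastforce simp: admits_def)
  qed
qed simp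

text \<open>\<open>Right\<close> reverses no link, so it serves as a neutral predecessor of the
  first link.\<close>

lemma position_iff_path: "position n w \<longleftrightarrow> length w = n \<and> path 0 Right w"
  using path_iff[of 0 Right w 0]
  by (auto simp: position_iff successively_Cons reverses_def)

lemma path_Right: "path h v w \<Longrightarrow> path h Right w"
  by (cases w) (auto simp: admits_def reverses_def)

text \<open>For a corner, the order \<open>l\<close>, \<open>Right\<close> demands the transition
  from \<open>v\<close> to \<open>l\<close>, and the order \<open>Right\<close>, \<open>l\<close>
  demands that the rest be a path from state \<open>l\<close>. These two demands imply the others,
  because \<open>Right\<close> constrains no neighbour.\<close>

lemma admissible_iff:
  "h \<in> {0..2} \<Longrightarrow> admissible h v c \<longleftrightarrow> well_formed c \<and> (\<forall>w \<in> language c. path h v w)"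
proof (induction c arbitrary: h v)
  case (Tip l)
  then show ?case by (auto simp: admits_def reverses_def)
next
  case (Fixed l c)
  then show ?case using language_nonempty[of c] by (auto simp: admits_def)
next
  case (Corner l c)
  have R: "admits h v Right" using Corner.prems by (auto simp: admits_def reverses_def)
  have N: "admits h v l \<Longrightarrow> admits h Right l \<and> admits (h + rise l) l Right"
    by (auto simp: admits_def reverses_def)
  show ?case
  proof (cases "admits h v l")
    case True
    then show ?thesis using Corner.IH[of "h + rise l" l] R N path_Right[of "h + rise l" l]
      by (auto simp: ball_Un admits_def)
  next
    \<comment> \<open>Some word of the language starts with \<open>l\<close>, since
      \<open>language c\<close> is nonempty, and the missing transition rejects it.\<close>
    case False
    then show ?thesis using language_nonempty[of c] by (auto simp: ball_Un)
  qed
qed simp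

lemma num_cubes_eq:
  "num_cubes n d = card {c. admissible 0 Right c \<and> cell_length c = n \<and> cell_dim c = d}"
proof -
  have eq: "{c. well_formed c \<and> (\<forall>w \<in> language c. position n w) \<and> cell_length c = n \<and> cell_dim c = d}
      = {c. admissible 0 Right c \<and> cell_length c = n \<and> cell_dim c = d}"
    using admissible_iff[of 0 Right] length_language by (auto simp: position_iff_path)
  have "inj_on language {c. admissible 0 Right c \<and> cell_length c = n \<and> cell_dim c = d}"
    using admissible_iff[of 0 Right] language_inject by (auto intro!: inj_onI)
  then show ?thesis by (simp add: num_cubes_def cubes_eq_language eq card_image)
qed

section \<open>Generating functions\<close>

unbundle fps_syntax

definition gf :: "cell set \<Rightarrow> rat fps fps" where
  "gf A = bivariate_fps (\<lambda>n d. of_nat (card {c \<in> A. cell_length c = n \<and> cell_dim c = d}))"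

lemma gf_nth: "gf A $ n $ d = of_nat (card {c \<in> A. cell_length c = n \<and> cell_dim c = d})"
  by (simp add: gf_def bivariate_fps_def)

section \<open>Coefficients, finiteness, and generating functions of the constructors\<close>

lemma var_nth:
  "(var_x * f) $ n = (if n = 0 then 0 else f $ (n - 1))"
  "(var_y * f) $ n $ d = (if d = 0 then 0 else f $ n $ (d - 1))"
  "var_x $ 0 = 0"
  "var_y $ n $ d = (if n = 0 \<and> d = 1 then 1 else 0)"
  by (simp_all add: var_x_def var_y_def)

lemma finite_link: "finite (A :: link set)"
proof (rule finite_subset)
  show "A \<subseteq> {Up, Down, Right}" using link.exhaust by auto
qed simp

text \<open>Without finiteness \<open>card\<close> would default to 0 and \<open>gf\<close> would
  not be additive. The strict bound makes the base case empty and covers the tails of both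
  \<open>Fixed\<close> and \<open>Corner\<close>.\<close>

lemma finite_cells: "finite {c. cell_length c < n}"
proof (induction n)
  case (Suc n)
  let ?A = "(UNIV :: link set) \<times> {c. cell_length c < n}"
  have "{c. cell_length c < Suc n} \<subseteq>
      insert Done (range Tip \<union> case_prod Fixed ` ?A \<union> case_prod Corner ` ?A)" (is "_ \<subseteq> ?B")
  proof
    fix c assume "c \<in> {c. cell_length c < Suc n}"
    then show "c \<in> ?B" by (cases c) (auto simp: image_iff)
  qed
  then show ?case
    by (rule finite_subset) (use finite_link[of UNIV] Suc in auto)
qed simp

lemma gf_Un: "A \<inter> B = {} \<Longrightarrow> gf (A \<union> B) = gf A + gf B"
proof (intro fps_ext)
  fix n d assume "A \<inter> B = {}"
  have fin: "finite {c \<in> X. cell_length c = n \<and> cell_dim c = d}" for X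
    by (rule finite_subset[OF _ finite_cells[of "Suc n"]]) auto
  have "card {c \<in> A \<union> B. cell_length c = n \<and> cell_dim c = d} =
      card {c \<in> A. cell_length c = n \<and> cell_dim c = d} +
      card {c \<in> B. cell_length c = n \<and> cell_dim c = d}"
    by (subst card_Un_disjoint[symmetric, OF fin fin])
      (use \<open>A \<inter> B = {}\<close> in \<open>auto intro!: arg_cong[of _ _ card]\<close>)
  then show "gf (A \<union> B) $ n $ d = (gf A + gf B) $ n $ d" by (simp add: gf_nth)
qed

lemma gf_empty: "gf {} = 0"
  by (intro fps_ext) (simp add: gf_nth)

lemma gf_Done: "gf {Done} = 1"
proof (intro fps_ext)
  fix n d
  have "{c \<in> {Done}. cell_length c = n \<and> cell_dim c = d} = (if n = 0 \<and> d = 0 then {Done} else {})"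
    by auto
  then show "gf {Done} $ n $ d = 1 $ n $ d" by (simp add: gf_nth)
qed

lemma gf_Tip: "gf {Tip l} = var_x * var_y"
proof (intro fps_ext)
  fix n d
  have "{c \<in> {Tip l}. cell_length c = n \<and> cell_dim c = d} = (if n = 1 \<and> d = 1 then {Tip l} else {})"
    by auto
  then show "gf {Tip l} $ n $ d = (var_x * var_y) $ n $ d"
    by (simp add: gf_nth var_nth)
qed

lemma gf_Fixed: "gf (Fixed l ` A) = var_x * gf A"
proof (intro fps_ext)
  fix n d
  have "{c \<in> Fixed l ` A. cell_length c = n \<and> cell_dim c = d} =
     (if n = 0 then {} else Fixed l ` {c \<in> A. cell_length c = n - 1 \<and> cell_dim c = d})"
    by auto
  then show "gf (Fixed l ` A) $ n $ d = (var_x * gf A) $ n $ d"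
    by (simp add: gf_nth var_nth card_image inj_on_def)
qed

lemma gf_Corner: "gf (Corner l ` A) = var_x^2 * var_y * gf A"
proof (intro fps_ext)
  fix n d
  have "{c \<in> Corner l ` A. cell_length c = n \<and> cell_dim c = d} =
     (if n < 2 \<or> d = 0 then {}
      else Corner l ` {c \<in> A. cell_length c = n - 2 \<and> cell_dim c = d - 1})"
    by auto
  then have "gf (Corner l ` A) $ n $ d =
     (if n < 2 \<or> d = 0 then 0 else gf A $ (n - 2) $ (d - 1))"
    by (simp add: gf_nth card_image inj_on_def)
  also have "\<dots> = (var_x * (var_x * (var_y * gf A))) $ n $ d"
    by (auto simp: var_nth numeral_2_eq_2)
  finally show "gf (Corner l ` A) $ n $ d = (var_x^2 * var_y * gf A) $ n $ d"
    by (simp only: power2_eq_square mult.assoc)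
qed

text \<open>For vertical \<open>l\<close>, these are the admissible cells whose first letter carries
  \<open>l\<close>. A fixed link and a corner lead to the same state, which gives the common weight
  \<open>x + x^2*y\<close>.\<close>

definition branch :: "int \<Rightarrow> link \<Rightarrow> link \<Rightarrow> cell set" where
  "branch h v l = (if admits h v l then
     {Tip l} \<union> (Fixed l ` Collect (admissible (h + rise l) l)
       \<union> Corner l ` Collect (admissible (h + rise l) l)) else {})"

lemma gf_branch:
  "gf (branch h v l) = (if admits h v l then
     var_x * var_y + (var_x + var_x^2 * var_y) * gf (Collect (admissible (h + rise l) l)) else 0)"
proof -
  have "gf ({Tip l} \<union> (Fixed l ` A \<union> Corner l ` A)) =
      var_x * var_y + (var_x + var_x^2 * var_y) * gf A" for A
  proof -
    have "gf ({Tip l} \<union> (Fixed l ` A \<union> Corner l ` A)) =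
        gf {Tip l} + (gf (Fixed l ` A) + gf (Corner l ` A))"
      by (subst gf_Un, force, subst gf_Un) auto
    then show ?thesis by (simp add: gf_Tip gf_Fixed gf_Corner distrib_right)
  qed
  then show ?thesis by (simp add: branch_def gf_empty)
qed

text \<open>This is the transfer equation of a state, obtained by splitting on the first letter. A
  step \<open>Right\<close> is always allowed and forgets \<open>v\<close>, so \<open>v\<close>
  matters only in the two vertical branches.\<close>

lemma gf_admissible:
  assumes "h \<in> {0..2}"
  shows "gf (Collect (admissible h v)) = 1 + var_x * gf (Collect (admissible h Right))
    + gf (branch h v Up) + gf (branch h v Down)"
proof -
  let ?R = "Fixed Right ` Collect (admissible h Right)"
  have R: "admits h v Right" using assms by (auto simp: admits_def reverses_def)
  have "c \<in> Collect (admissible h v) \<longleftrightarrow>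
      c \<in> {Done} \<union> (?R \<union> (branch h v Up \<union> branch h v Down))" for c
  proof (cases c)
    case (Tip l)
    then show ?thesis by (cases l) (auto simp: branch_def)
  next
    case (Fixed l b)
    then show ?thesis using R by (cases l) (auto simp: branch_def)
  next
    case (Corner l b)
    then show ?thesis by (cases l) (auto simp: branch_def)
  qed simp
  then have "Collect (admissible h v) = {Done} \<union> (?R \<union> (branch h v Up \<union> branch h v Down))"
    by blast
  also have "gf \<dots> = gf {Done} + (gf ?R + (gf (branch h v Up) + gf (branch h v Down)))"
    by (subst gf_Un, force simp: branch_def, subst gf_Un, force simp: branch_def, subst gf_Un)
      (auto simp: branch_def)
  finally show ?thesis by (simp add: gf_Done gf_Fixed add.assoc)
qed

text \<open>The unknowns are the states: \<open>P\<close>, \<open>Q\<close> at height 0 after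
  \<open>Right\<close>, \<open>Down\<close>; \<open>M\<close>, \<open>T\<close>, \<open>S\<close> at
  height 1 after \<open>Right\<close>, \<open>Up\<close>, \<open>Down\<close>; \<open>N\<close>,
  \<open>R\<close> at height 2 after \<open>Right\<close>, \<open>Up\<close>. An integral domain
  lacks division, so a nonzero factor is cancelled instead.\<close>

lemma transfer_elimination:
  fixes x y P Q M S T R N :: "'a :: idom"
  defines "a \<equiv> x + x^2 * y" and "e \<equiv> x * y"
  assumes P: "P = 1 + x * P + (e + a * T)"
    and Q: "Q = 1 + x * P"
    and M: "M = 1 + x * M + (e + a * R) + (e + a * Q)"
    and T: "T = 1 + x * M + (e + a * R)"
    and S: "S = 1 + x * M + (e + a * Q)"
    and N: "N = 1 + x * N + (e + a * S)"
    and R: "R = 1 + x * N"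
    and nz: "1 - x + a^2 * x \<noteq> 0"
  shows "P * (1 - 2*x + x^2 - x^3 - x^4 - 2*x^4*y - 2*x^5*y - x^5*y^2 - x^6*y^2) =
    1 + x*y + x^2 + x^2*y + x^3 + 3*x^3*y + x^3*y^2 + 2*x^4*y + 2*x^4*y^2 + x^5*y^2"
proof -
  \<comment> \<open>Reflecting the strip exchanges \<open>P\<close> with \<open>N\<close>,
    \<open>Q\<close> with \<open>R\<close> and \<open>T\<close> with \<open>S\<close>.
    Algebraically, \<open>P - N = x*(P - N) + a*(T - S)\<close>, where
    \<open>T - S = a*(R - Q)\<close> and \<open>R - Q = x*(N - P)\<close>.\<close>
  have "(1 - x + a^2 * x) * (P - N) = 0"
    using P Q T S N R by algebra
  then have "P = N" using nz by simp
  then have "R = Q" using Q R by simp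
  \<comment> \<open>With \<open>R = Q\<close>, multiplying the equation for \<open>T\<close> by
    \<open>1 - x\<close> eliminates \<open>M\<close> and gives
    \<open>(1 - x)*T = 1 + (1 + x)*(e + a*Q)\<close>. This goes into the equation for
    \<open>P\<close>, also multiplied by \<open>1 - x\<close>.\<close>
  have "P * ((1 - x)^2 - a^2 * x * (1 + x)) = (1 + e) * (1 - x) + a * (1 + (1 + x) * (a + e))"
    using P Q M T \<open>R = Q\<close> by algebra
  then show ?thesis unfolding a_def e_def by algebra
qed

theorem theorem1p4:
  shows "let x = var_x; y = var_y in
    bivariate_fps (\<lambda>n d. of_nat (num_cubes n d)) =
      (1 + x*y + x^2 + x^2*y + x^3 + 3*x^3*y + x^3*y^2 + 2*x^4*y + 2*x^4*y^2 + x^5*y^2) /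
      (1 - 2*x + x^2 - x^3 - x^4 - 2*x^4*y - 2*x^5*y - x^5*y^2 - x^6*y^2)"
proof -
  define G where "G h v = gf (Collect (admissible h v))" for h v
  let ?x = var_x and ?y = var_y
  have "(1 - ?x + (?x + ?x^2 * ?y)^2 * ?x) $ 0 = 1"
    by (simp add: var_nth(3))
  then have nz: "1 - ?x + (?x + ?x^2 * ?y)^2 * ?x \<noteq> 0"
    by (metis fps_zero_nth zero_neq_one)
  have "G 0 Right * (1 - 2*?x + ?x^2 - ?x^3 - ?x^4 - 2*?x^4*?y - 2*?x^5*?y - ?x^5*?y^2 - ?x^6*?y^2) =
    1 + ?x*?y + ?x^2 + ?x^2*?y + ?x^3 + 3*?x^3*?y + ?x^3*?y^2 + 2*?x^4*?y + 2*?x^4*?y^2 + ?x^5*?y^2"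
  \<comment> \<open>There is one transfer equation for each of the seven reachable states; steps
    that leave the strip or reverse contribute 0.\<close>
  proof (rule transfer_elimination[OF _ _ _ _ _ _ _ nz])
    show "G 0 Right = 1 + ?x * G 0 Right + (?x * ?y + (?x + ?x^2 * ?y) * G 1 Up)"
      unfolding G_def by (subst gf_admissible) (simp_all add: gf_branch admits_def reverses_def)
    show "G 0 Down = 1 + ?x * G 0 Right"
      unfolding G_def by (subst gf_admissible) (simp_all add: gf_branch admits_def reverses_def)
    show "G 1 Right = 1 + ?x * G 1 Right + (?x * ?y + (?x + ?x^2 * ?y) * G 2 Up)
        + (?x * ?y + (?x + ?x^2 * ?y) * G 0 Down)"
      unfolding G_def by (subst gf_admissible) (simp_all add: gf_branch admits_def reverses_def)
    show "G 1 Up = 1 + ?x * G 1 Right + (?x * ?y + (?x + ?x^2 * ?y) * G 2 Up)"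
      unfolding G_def by (subst gf_admissible) (simp_all add: gf_branch admits_def reverses_def)
    show "G 1 Down = 1 + ?x * G 1 Right + (?x * ?y + (?x + ?x^2 * ?y) * G 0 Down)"
      unfolding G_def by (subst gf_admissible) (simp_all add: gf_branch admits_def reverses_def)
    show "G 2 Right = 1 + ?x * G 2 Right + (?x * ?y + (?x + ?x^2 * ?y) * G 1 Down)"
      unfolding G_def by (subst gf_admissible) (simp_all add: gf_branch admits_def reverses_def)
    show "G 2 Up = 1 + ?x * G 2 Right"
      unfolding G_def by (subst gf_admissible) (simp_all add: gf_branch admits_def reverses_def)
  qed
  moreover have "bivariate_fps (\<lambda>n d. of_nat (num_cubes n d)) = G 0 Right"
    by (simp add: G_def gf_def num_cubes_eq)
  \<comment> \<open>The constant term 1 makes the denominator invertible, so the product identity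
    becomes the stated quotient.\<close>
  moreover have "(1 - 2*?x + ?x^2 - ?x^3 - ?x^4 - 2*?x^4*?y - 2*?x^5*?y - ?x^5*?y^2 - ?x^6*?y^2) $ 0 = 1"
    by (simp add: var_nth(3) fps_power_zeroth)
  ultimately show ?thesis
    unfolding Let_def by (simp only: bivariate_fps_quotient_iff)
qed

end
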